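(* Let $\tau>0$ and consider the linear delay system $$x'(t)=k(t)y(t-\tau)-a(t)x(t-\tau),\qquad y'(t)=l(t)x(t-\tau)-b(t)y(t-\tau),$$ with $a,b,k,l$ continuous and nonnegative functions on $[t_0,\infty)$, and $a(t),b(t)$ positive. Define $$c_1(t)=a(t)\int_{t-\tau}^t(a(u)+k(u))\,du,\qquad c_2(t)=b(t)\int_{t-\tau}^t(b(u)+l(u))\,du.$$ Suppose that one of the following conditions is satisfied: (a) $a(t),b(t),k(t),l(t)$ are bounded and there exists a constant vector $v=(v_1,v_2)$ with $v_1,v_2>0$ such that $$\liminf_{t\to\infty}\hat M(t)v>0,\qquad\text{where}\quad \hat M(t)=\begin{pmatrix}a(t)-c_1(t)&-k(t)\\ -l(t)&b(t)-c_2(t)\end{pmatrix};$$ (b) $a(t),b(t)$ are bounded from below by positive constants and there exist $\alpha>1$ and a constant vector $v=(v_1,v_2)$ with $v_1,v_2>0$ such that, for all sufficiently large $t$, $$\mathrm{diag}(a(t),b(t))\,v\ge\alpha\begin{pmatrix}c_1(t)&k(t)\\ l(t)&c_2(t)\end{pmatrix}v.$$ Then the system is exponentially asymptotically stable.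
   Context: Vector inequalities and the $\liminf$ of a vector function are understood componentwise; $c_1(t),c_2(t)$ are considered for $t\ge t_0+\tau$. The phase space is $C=C([-\tau,0];\mathbb R^2)$ with the supremum norm. The linear system is exponentially asymptotically stable (EAS) if there are $K,\beta>0$ such that, for every $s\ge t_0$ and $\phi\in C$, the solution $X(t)=(x(t),y(t))$ with $X(s+\theta)=\phi(\theta)$, $\theta\in[-\tau,0]$, satisfies $|X(t)|\le Ke^{-\beta(t-s)}\|\phi\|$ for all $t\ge s$. *)

theory Defs
  imports "HOL-Analysis.Analysis"
begin

definition hist_norm :: "real \<Rightarrow> (real \<Rightarrow> real^2) \<Rightarrow> real" where
  "hist_norm \<tau> \<phi> = (SUP \<theta>\<in>{-\<tau>..0}. norm (\<phi> \<theta>))"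

text \<open>
  A solution with initial time \<open>s\<close> is continuous on \<open>[s - \<tau>, \<infinity>)\<close>, equals the initial function
  on \<open>[s - \<tau>, s]\<close> and satisfies the equations for all \<open>t \<ge> s\<close>, the derivative
  at \<open>t = s\<close> being the right-hand one. The values of \<open>X\<close> to the left of \<open>s - \<tau>\<close>
  are irrelevant.
\<close>
definition delay_solution ::
  "real \<Rightarrow> (real \<Rightarrow> real) \<Rightarrow> (real \<Rightarrow> real) \<Rightarrow> (real \<Rightarrow> real) \<Rightarrow> (real \<Rightarrow> real) \<Rightarrow>
   real \<Rightarrow> (real \<Rightarrow> real^2) \<Rightarrow> (real \<Rightarrow> real^2) \<Rightarrow> bool" where
  "delay_solution \<tau> a b k l s \<phi> X \<longleftrightarrow>
     continuous_on {s - \<tau>..} X \<and>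
     (\<forall>\<theta>\<in>{-\<tau>..0}. X (s + \<theta>) = \<phi> \<theta>) \<and>
     (\<forall>t\<ge>s.
        ((\<lambda>r. X r $ 1) has_real_derivative (k t * X (t - \<tau>) $ 2 - a t * X (t - \<tau>) $ 1))
          (at t within {s..}) \<and>
        ((\<lambda>r. X r $ 2) has_real_derivative (l t * X (t - \<tau>) $ 1 - b t * X (t - \<tau>) $ 2))
          (at t within {s..}))"

text \<open>
  The norm on \<open>real^2\<close> is the Euclidean one; since all norms on the plane are equivalent, the choice
  only affects the constant \<open>K\<close>. Solutions are uniquely determined by their initial data
  on \<open>[s - \<tau>, \<infinity>)\<close> (method of steps), hence the quantification over all solutions \<open>X\<close>.
\<close>
definition exp_asymp_stable ::
  "real \<Rightarrow> real \<Rightarrow> (real \<Rightarrow> real) \<Rightarrow> (real \<Rightarrow> real) \<Rightarrow> (real \<Rightarrow> real) \<Rightarrow> (real \<Rightarrow> real) \<Rightarrow> bool" where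
  "exp_asymp_stable t0 \<tau> a b k l \<longleftrightarrow>
     (\<exists>K>0. \<exists>\<beta>>0. \<forall>s\<ge>t0. \<forall>\<phi> X.
        continuous_on {-\<tau>..0} \<phi> \<and> delay_solution \<tau> a b k l s \<phi> X \<longrightarrow>
        (\<forall>t\<ge>s. norm (X t) \<le> K * exp (- \<beta> * (t - s)) * hist_norm \<tau> \<phi>))"

text \<open>
  \<open>cfun \<tau> a k\<close> is \<open>c\<^sub>1\<close> and \<open>cfun \<tau> b l\<close> is \<open>c\<^sub>2\<close>; meaningful for \<open>t \<ge> t0 + \<tau>\<close> only.
\<close>
definition cfun :: "real \<Rightarrow> (real \<Rightarrow> real) \<Rightarrow> (real \<Rightarrow> real) \<Rightarrow> real \<Rightarrow> real" where
  "cfun \<tau> p q t = p t * integral {t - \<tau>..t} (\<lambda>u. p u + q u)"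

definition mat2 :: "real \<Rightarrow> real \<Rightarrow> real \<Rightarrow> real \<Rightarrow> real^2^2" where
  "mat2 p q r s = vector [vector [p, q], vector [r, s]]"

definition M_hat ::
  "real \<Rightarrow> (real \<Rightarrow> real) \<Rightarrow> (real \<Rightarrow> real) \<Rightarrow> (real \<Rightarrow> real) \<Rightarrow> (real \<Rightarrow> real) \<Rightarrow> real \<Rightarrow> real^2^2" where
  "M_hat \<tau> a b k l t =
     mat2 (a t - cfun \<tau> a k t) (- k t)
          (- l t)              (b t - cfun \<tau> b l t)"

end

theory Submission imports Defs begin

text \<open>
  Put \<open>\<rho> = v\<^sub>2 / v\<^sub>1\<close> and replace \<open>y\<close> by \<open>y / \<rho>\<close>. The system becomes
  \<open>x' = K y(t - \<tau>) - a x(t - \<tau>)\<close>, \<open>y' = L x(t - \<tau>) - b y(t - \<tau>)\<close> with \<open>K = \<rho> k\<close> and \<open>L = l / \<rho>\<close>.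
  Each of the two alternative hypotheses says that, for all large \<open>t\<close>, \<open>a\<close> is bounded below and
  \<open>c\<^sub>1 + K \<le> \<gamma> a\<close> with some \<open>\<gamma> < 1\<close>, and likewise for \<open>b\<close> (\<open>row_dominated\<close>). Since
  \<open>c\<^sub>1(t) \<ge> a(t) \<integral>a\<close>, the integral being over \<open>[t - \<tau>, t]\<close>, this yields
  \<open>K(t) \<le> a(t) (\<gamma> - \<integral>a)\<close>. From here on, everything rests on this inequality and its twin for \<open>L\<close>.

  The heart of the matter is a contraction estimate (\<open>peak_bound\<close>): if \<open>|x|, |y| \<le> N\<close> on
  \<open>[t - 3\<tau>, t]\<close> and \<open>x\<close> is not decreasing at \<open>t\<close>, then \<open>x(t) \<le> \<gamma> N\<close>; a slow decrease of \<open>x\<close> at \<open>t\<close>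
  costs only a small \<open>\<epsilon>\<close>. The usual estimate, which writes \<open>x(t - \<tau>)\<close> as \<open>x(t) - \<integral>x'\<close> and bounds \<open>x'\<close>
  by \<open>(a + K) N\<close>, loses too much: it brings in \<open>\<integral>K\<close>, that is \<open>\<rho> \<integral>k\<close>, where \<open>c\<^sub>1\<close> contains only
  \<open>\<integral>k\<close>. What saves the situation is a trade-off: for \<open>x\<close> to rise from very negative values to a
  positive one at \<open>t - \<tau>\<close>, the integral of \<open>a\<close> before \<open>t - \<tau>\<close> has to be large, and then \<open>K\<close> is
  small compared with \<open>a\<close> just after \<open>t - \<tau>\<close>.

  Exponential decay follows by a maximum argument (\<open>exponential_decay_of_dominance\<close>). For small
  \<open>\<beta> > 0\<close>, look at the maximum of \<open>exp (\<beta> t) max(|x(t)|, |y(t)|)\<close> over a compact interval. At a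
  late maximum point the component that realises it decreases at relative rate at most \<open>\<beta>\<close>, and the
  preceding values on a window of length \<open>3\<tau>\<close> exceed the current one by a factor of at most
  \<open>exp (3\<beta>\<tau>)\<close>, so the contraction estimate is violated. Hence the maximum occurs within a time span
  whose length does not depend on \<open>s\<close>, and there the solution is controlled by the
  method of steps (\<open>growth_by_steps\<close>). The constants are uniform in \<open>s\<close>, as the integral of all
  coefficients over a window of length \<open>\<tau>\<close> is bounded: by compactness for early windows, by the
  dominance condition for late ones.
\<close>

section \<open>Monotonicity with one-sided derivatives\<close>

lemma increment_le_of_derivative_le:
  fixes f g :: "real \<Rightarrow> real"
  assumes "p \<le> q"
    and df: "\<And>u. u \<in> {p..q} \<Longrightarrow> (f has_real_derivative f' u) (at u within {p..q})"
    and dg: "\<And>u. u \<in> {p..q} \<Longrightarrow> (g has_real_derivative g' u) (at u within {p..q})"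
    and le: "\<And>u. u \<in> {p..q} \<Longrightarrow> f' u \<le> g' u"
  shows "f q - f p \<le> g q - g p"
proof (cases "p = q")
  case False
  with assms(1) have "p < q" by simp
  have "\<And>u. p \<le> u \<Longrightarrow> u \<le> q \<Longrightarrow> ((\<lambda>u. g u - f u) has_derivative (*) (g' u - f' u)) (at u within {p..q})"
    using DERIV_diff[OF dg df] by (auto simp: has_field_derivative_def)
  from mvt_simple[OF \<open>p < q\<close> this] obtain z where
    z: "z \<in> {p<..<q}" "(g q - f q) - (g p - f p) = (g' z - f' z) * (q - p)" by auto
  have "(g' z - f' z) * (q - p) \<ge> 0" using z(1) le[of z] \<open>p < q\<close> by auto
  with z(2) show ?thesis by linarith
qed simp

lemma le_of_derivative_nonneg:
  fixes g :: "real \<Rightarrow> real"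
  assumes "p \<le> q"
    and "\<And>u. u \<in> {p..q} \<Longrightarrow> (g has_real_derivative g' u) (at u within {p..q})"
    and "\<And>u. u \<in> {p..q} \<Longrightarrow> 0 \<le> g' u"
  shows "g p \<le> g q"
  using increment_le_of_derivative_le[of p q "\<lambda>_. 0" "\<lambda>_. 0" g g'] assms by simp

lemma derivative_nonneg_at_right_end_max:
  fixes f :: "real \<Rightarrow> real"
  assumes d: "(f has_real_derivative D) (at t within {s..t})" and "s < t"
    and max: "\<And>u. u \<in> {s..t} \<Longrightarrow> f u \<le> f t"
  shows "D \<ge> 0"
proof (rule ccontr)
  assume "\<not> D \<ge> 0"
  with has_real_derivative_neg_dec_left[OF d] obtain e where
    e: "e > 0" "\<And>h. h > 0 \<Longrightarrow> t - h \<in> {s..t} \<Longrightarrow> h < e \<Longrightarrow> f t < f (t - h)" by auto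
  define h where "h = min (e/2) (t - s)"
  have h: "h > 0" "h < e" "t - h \<in> {s..t}" using e(1) \<open>s < t\<close> by (auto simp: h_def)
  from e(2)[OF h(1,3,2)] max[OF h(3)] show False by linarith
qed

section \<open>The contraction estimate at a peak\<close>

text \<open>
  Here \<open>P\<close> is a primitive of \<open>a\<close>. Write \<open>\<xi> = x(t - \<tau>)\<close>, \<open>\<theta> = P(t) - P(t - \<tau>)\<close> and, for \<open>u\<close> in
  \<open>[t - \<tau>, t]\<close>, \<open>w(u) = P(u) - P(t - \<tau>)\<close> and \<open>A(u) = P(t - \<tau>) - P(u - \<tau>)\<close>, so that the integral
  of \<open>a\<close> over \<open>[u - \<tau>, u]\<close> is \<open>A + w\<close>. The peak condition and the bound on \<open>K(t)\<close> give
  \<open>\<xi> \<le> (\<gamma> - \<theta> + \<epsilon>) N\<close>. The delayed value \<open>-x(u - \<tau>)\<close> is at most \<open>N\<close>, but also at most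
  \<open>2 N A(u) - \<xi>\<close>, as \<open>|x'| \<le> 2 a N\<close>. The average of these two bounds is \<open>N/2 + N A - \<xi>/2\<close>, and its
  term \<open>N A\<close> cancels against the one in \<open>K y(u - \<tau>) \<le> a (\<gamma> - A - w) N\<close>. What is left,
  \<open>x'(u) \<le> a (N (\<gamma> + 1/2 - w) - \<xi>/2)\<close>, can be integrated in closed form in the variable \<open>w\<close>; the
  resulting bound increases with \<open>\<xi>\<close>, and the largest possible \<open>\<xi>\<close> gives the claim.
\<close>
lemma peak_bound:
  fixes x y a K P :: "real \<Rightarrow> real"
  assumes "\<tau> > 0"
    and dP: "\<And>u. u \<in> {t-3*\<tau>..t} \<Longrightarrow> (P has_real_derivative a u) (at u within {t-3*\<tau>..t})"
    and dx: "\<And>u. u \<in> {t-2*\<tau>..t} \<Longrightarrow>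
               (x has_real_derivative (K u * y (u - \<tau>) - a u * x (u - \<tau>))) (at u within {t-2*\<tau>..t})"
    and a: "\<And>u. u \<in> {t-3*\<tau>..t} \<Longrightarrow> a u > 0"
    and K0: "\<And>u. u \<in> {t-2*\<tau>..t} \<Longrightarrow> 0 \<le> K u"
    and K: "\<And>u. u \<in> {t-2*\<tau>..t} \<Longrightarrow> K u \<le> a u * (\<gamma> - (P u - P (u - \<tau>)))"
    and xN: "\<And>u. u \<in> {t-3*\<tau>..t} \<Longrightarrow> \<bar>x u\<bar> \<le> N"
    and yN: "\<And>u. u \<in> {t-3*\<tau>..t} \<Longrightarrow> \<bar>y u\<bar> \<le> N"
    and "\<gamma> \<le> 1" "\<epsilon> \<ge> 0"
    and peak: "K t * y (t - \<tau>) - a t * x (t - \<tau>) \<ge> - (\<epsilon> * a t * N)"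
  shows "x t \<le> (\<gamma> + \<epsilon>) * N"
proof -
  define \<xi> where "\<xi> = x (t - \<tau>)"
  define \<theta> where "\<theta> = P t - P (t - \<tau>)"
  have "N \<ge> 0" using xN[of t] \<open>\<tau> > 0\<close> by auto
  have P_mono: "P p \<le> P q" if "t - 3*\<tau> \<le> p" "p \<le> q" "q \<le> t" for p q
    by (rule le_of_derivative_nonneg[of p q P a])
       (use that a in \<open>auto intro: DERIV_subset[OF dP] order.strict_implies_order\<close>)
  have Ka: "K u \<le> a u" if "u \<in> {t-2*\<tau>..t}" for u
  proof -
    have "K u \<le> a u * (\<gamma> - (P u - P (u - \<tau>)))" by (rule K[OF that])
    also have "\<dots> \<le> a u * 1"
      using that a[of u] \<open>\<gamma> \<le> 1\<close> P_mono[of "u - \<tau>" u] \<open>\<tau> > 0\<close> by (intro mult_left_mono) auto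
    finally show ?thesis by simp
  qed
  have \<theta>: "0 \<le> \<theta>" "\<theta> \<le> \<gamma>"
  proof -
    show "0 \<le> \<theta>" using P_mono[of "t - \<tau>" t] \<open>\<tau> > 0\<close> by (simp add: \<theta>_def)
    have "0 \<le> a t * (\<gamma> - \<theta>)" using K0[of t] K[of t] \<open>\<tau> > 0\<close> by (auto simp: \<theta>_def)
    then show "\<theta> \<le> \<gamma>" using a[of t] \<open>\<tau> > 0\<close> by (simp add: zero_le_mult_iff)
  qed
  have \<xi>: "\<xi> \<le> (\<gamma> - \<theta> + \<epsilon>) * N"
  proof -
    have "K t * y (t - \<tau>) \<le> K t * N"
      using K0[of t] yN[of "t - \<tau>"] \<open>\<tau> > 0\<close> by (intro mult_left_mono) auto
    also have "\<dots> \<le> a t * (\<gamma> - \<theta>) * N"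
      using K[of t] \<open>\<tau> > 0\<close> \<open>N \<ge> 0\<close> by (intro mult_right_mono) (auto simp: \<theta>_def)
    finally have "a t * \<xi> \<le> a t * ((\<gamma> - \<theta> + \<epsilon>) * N)"
      using peak by (simp add: \<xi>_def algebra_simps)
    then show ?thesis using a[of t] \<open>\<tau> > 0\<close> by simp
  qed
  \<comment> \<open>How far \<open>x\<close> can rise before \<open>t - \<tau>\<close> is limited by the integral of \<open>a\<close> over that time.\<close>
  have swing: "\<xi> - x (u - \<tau>) \<le> 2 * N * (P (t - \<tau>) - P (u - \<tau>))" if "u \<in> {t-\<tau>..t}" for u
  proof -
    have "x (t - \<tau>) - x (u - \<tau>) \<le> 2 * N * P (t - \<tau>) - 2 * N * P (u - \<tau>)"
    proof (rule increment_le_of_derivative_le)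
      fix r assume "r \<in> {u - \<tau>..t - \<tau>}"
      then have r: "r \<in> {t-2*\<tau>..t}" "r \<in> {t-3*\<tau>..t}" "r - \<tau> \<in> {t-3*\<tau>..t}"
        using that \<open>\<tau> > 0\<close> by auto
      show "(x has_real_derivative (K r * y (r - \<tau>) - a r * x (r - \<tau>))) (at r within {u - \<tau>..t - \<tau>})"
        by (rule DERIV_subset[OF dx[OF r(1)]]) (use that \<open>\<tau> > 0\<close> in auto)
      show "((\<lambda>r. 2 * N * P r) has_real_derivative 2 * N * a r) (at r within {u - \<tau>..t - \<tau>})"
        by (rule DERIV_cmult, rule DERIV_subset[OF dP[OF r(2)]]) (use that \<open>\<tau> > 0\<close> in auto)
      have "K r * y (r - \<tau>) \<le> a r * N"
        using mult_left_mono[OF abs_le_D1[OF yN[OF r(3)]] K0[OF r(1)]]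
          mult_right_mono[OF Ka[OF r(1)] \<open>N \<ge> 0\<close>] by linarith
      moreover have "a r * (- x (r - \<tau>)) \<le> a r * N"
        using xN[OF r(3)] a[OF r(2)] by (intro mult_left_mono) auto
      ultimately show "K r * y (r - \<tau>) - a r * x (r - \<tau>) \<le> 2 * N * a r" by (simp add: algebra_simps)
    qed (use that in auto)
    then show ?thesis by (simp add: \<xi>_def algebra_simps)
  qed
  \<comment> \<open>\<open>G\<close> is the primitive of the averaged bound on \<open>x'\<close>, expressed through \<open>w\<close>.\<close>
  define c where "c = N * (\<gamma> + 1/2) - \<xi> / 2"
  define G where "G u = c * (P u - P (t - \<tau>)) - N / 2 * (P u - P (t - \<tau>))^2" for u
  have "x t - x (t - \<tau>) \<le> G t - G (t - \<tau>)"
  proof (rule increment_le_of_derivative_le)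
    fix u assume u: "u \<in> {t - \<tau>..t}"
    then have u': "u \<in> {t-2*\<tau>..t}" "u \<in> {t-3*\<tau>..t}" "u - \<tau> \<in> {t-3*\<tau>..t}"
      using \<open>\<tau> > 0\<close> by auto
    show "(x has_real_derivative (K u * y (u - \<tau>) - a u * x (u - \<tau>))) (at u within {t - \<tau>..t})"
      by (rule DERIV_subset[OF dx[OF u'(1)]]) (use \<open>\<tau> > 0\<close> in auto)
    have "(P has_real_derivative a u) (at u within {t - \<tau>..t})"
      by (rule DERIV_subset[OF dP[OF u'(2)]]) (use \<open>\<tau> > 0\<close> in auto)
    then show "(G has_real_derivative a u * (c - N * (P u - P (t - \<tau>)))) (at u within {t - \<tau>..t})"
      unfolding G_def by (auto intro!: derivative_eq_intros simp: field_simps)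
    have "K u * y (u - \<tau>) \<le> K u * N"
      using K0[OF u'(1)] yN[OF u'(3)] by (intro mult_left_mono) auto
    also have "\<dots> \<le> a u * (\<gamma> - (P u - P (u - \<tau>))) * N"
      using K[OF u'(1)] \<open>N \<ge> 0\<close> by (intro mult_right_mono) auto
    finally have 1: "K u * y (u - \<tau>) \<le> a u * (\<gamma> - (P u - P (u - \<tau>))) * N" .
    \<comment> \<open>The average of \<open>- x (u - \<tau>) \<le> N\<close> and the bound from \<open>swing\<close>.\<close>
    have "- x (u - \<tau>) \<le> N / 2 + N * (P (t - \<tau>) - P (u - \<tau>)) - \<xi> / 2"
      using swing[OF u] xN[OF u'(3)] by (simp add: abs_le_iff field_simps)
    then have "a u * (- x (u - \<tau>)) \<le> a u * (N / 2 + N * (P (t - \<tau>) - P (u - \<tau>)) - \<xi> / 2)"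
      using a[OF u'(2)] by (intro mult_left_mono) auto
    with 1 show "K u * y (u - \<tau>) - a u * x (u - \<tau>) \<le> a u * (c - N * (P u - P (t - \<tau>)))"
      by (simp add: c_def algebra_simps)
  qed (use \<open>\<tau> > 0\<close> in auto)
  then have "x t \<le> \<xi> + (c * \<theta> - N / 2 * \<theta>^2)" by (simp add: G_def \<xi>_def \<theta>_def)
  also have "\<dots> = \<xi> * (1 - \<theta>/2) + N * (\<gamma> + 1/2) * \<theta> - N / 2 * \<theta>^2"
    by (simp add: c_def algebra_simps)
  also have "\<dots> \<le> (\<gamma> - \<theta> + \<epsilon>) * N * (1 - \<theta>/2) + N * (\<gamma> + 1/2) * \<theta> - N / 2 * \<theta>^2"
    using mult_right_mono[OF \<xi>, of "1 - \<theta>/2"] \<theta> \<open>\<gamma> \<le> 1\<close> by simp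
  also have "\<dots> = (\<gamma> + \<epsilon>) * N - N * \<theta> * (1 - \<gamma> + \<epsilon>) / 2"
    by (simp add: field_simps power2_eq_square)
  also have "\<dots> \<le> (\<gamma> + \<epsilon>) * N"
    using \<open>N \<ge> 0\<close> \<theta> \<open>\<gamma> \<le> 1\<close> \<open>\<epsilon> \<ge> 0\<close> by simp
  finally show ?thesis .
qed

section \<open>Primitives of the coefficients\<close>

lemma primitive_has_derivative:
  fixes f :: "real \<Rightarrow> real"
  assumes "continuous_on {t0..} f" "u \<ge> t0"
  shows "((\<lambda>u. integral {t0..u} f) has_real_derivative f u) (at u within {t0..})"
proof -
  have "((\<lambda>u. integral {t0..u} f) has_real_derivative f u) (at u within {t0..u+1})"
    by (rule integral_has_real_derivative) (use assms in \<open>auto intro: continuous_on_subset\<close>)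
  moreover have "at u within {t0..u+1} = at u within {t0..}"
    by (rule at_within_nhd[of _ "{..<u+1}"]) auto
  ultimately show ?thesis by simp
qed

lemma integral_window:
  fixes f :: "real \<Rightarrow> real"
  assumes "continuous_on {t0..} f" "t0 \<le> p" "p \<le> q"
  shows "integral {p..q} f = integral {t0..q} f - integral {t0..p} f"
proof -
  have "f integrable_on {t0..q}"
    by (rule integrable_continuous_real) (use assms in \<open>auto intro: continuous_on_subset\<close>)
  then show ?thesis using Henstock_Kurzweil_Integration.integral_combine[of t0 p q f] assms by simp
qed

lemma window_bound:
  fixes Q :: "real \<Rightarrow> real"
  assumes "continuous_on {t0..} Q" "\<tau> \<ge> 0" "\<And>u. u \<ge> T \<Longrightarrow> Q (u + \<tau>) - Q u \<le> H0"
  shows "\<exists>H\<ge>0. \<forall>u\<ge>t0. Q (u + \<tau>) - Q u \<le> H"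
proof -
  have "continuous_on {t0..T} (\<lambda>u. Q (u + \<tau>) - Q u)"
    by (intro continuous_intros continuous_on_compose2[OF assms(1)] continuous_on_subset[OF assms(1)])
       (use assms(2) in auto)
  then have "bdd_above ((\<lambda>u. Q (u + \<tau>) - Q u) ` {t0..T})"
    by (intro bounded_imp_bdd_above compact_imp_bounded compact_continuous_image) auto
  then obtain H1 where "\<forall>d \<in> (\<lambda>u. Q (u + \<tau>) - Q u) ` {t0..T}. d \<le> H1"
    unfolding bdd_above_def by blast
  then have "\<And>u. u \<in> {t0..T} \<Longrightarrow> Q (u + \<tau>) - Q u \<le> H1" by blast
  then have "\<forall>u\<ge>t0. Q (u + \<tau>) - Q u \<le> max 0 (max H0 H1)"
    using assms(3) by (smt (verit) atLeastAtMost_iff)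
  then show ?thesis by (intro exI[of _ "max 0 (max H0 H1)"]) auto
qed

section \<open>Growth on bounded time spans\<close>

text \<open>
  Method of steps: on an interval of length \<open>\<tau>\<close> the right-hand side involves only earlier values, so
  the increment is at most the bound reached so far times the integral of the coefficients over
  that interval. Each step therefore costs a factor \<open>1 + H\<close>, whatever the initial time is.
\<close>
lemma growth_by_steps:
  fixes x y a b K L Q :: "real \<Rightarrow> real"
  assumes "\<tau> > 0"
    and dQ: "\<And>u. u \<ge> s \<Longrightarrow> (Q has_real_derivative (a u + b u + K u + L u)) (at u within {s..})"
    and H: "\<And>u. u \<ge> s \<Longrightarrow> Q (u + \<tau>) - Q u \<le> H"
    and nonneg: "\<And>u. u \<ge> s \<Longrightarrow> a u \<ge> 0" "\<And>u. u \<ge> s \<Longrightarrow> b u \<ge> 0"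
                "\<And>u. u \<ge> s \<Longrightarrow> K u \<ge> 0" "\<And>u. u \<ge> s \<Longrightarrow> L u \<ge> 0"
    and dx: "\<And>u. u \<ge> s \<Longrightarrow>
               (x has_real_derivative (K u * y (u - \<tau>) - a u * x (u - \<tau>))) (at u within {s..})"
    and dy: "\<And>u. u \<ge> s \<Longrightarrow>
               (y has_real_derivative (L u * x (u - \<tau>) - b u * y (u - \<tau>))) (at u within {s..})"
    and init: "\<And>u. u \<in> {s-\<tau>..s} \<Longrightarrow> \<bar>x u\<bar> \<le> B \<and> \<bar>y u\<bar> \<le> B"
    and "t \<in> {s-\<tau>..s + real n * \<tau>}"
  shows "\<bar>x t\<bar> \<le> (1 + H)^n * B \<and> \<bar>y t\<bar> \<le> (1 + H)^n * B"
  using \<open>t \<in> _\<close>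
proof (induction n arbitrary: t)
  case 0
  then show ?case using init by simp
next
  case (Suc n)
  define p where "p = s + real n * \<tau>"
  define C where "C = (1 + H)^n * B"
  have IH: "\<bar>x u\<bar> \<le> C" "\<bar>y u\<bar> \<le> C" if "u \<in> {s-\<tau>..p}" for u
    using Suc.IH[of u] that by (auto simp: C_def p_def)
  have "p \<ge> s" using \<open>\<tau> > 0\<close> by (simp add: p_def)
  have "C \<ge> 0" using IH(1)[of p] \<open>p \<ge> s\<close> \<open>\<tau> > 0\<close> by auto
  have Q_mono: "Q p' \<le> Q q'" if "s \<le> p'" "p' \<le> q'" for p' q'
    by (rule le_of_derivative_nonneg[of p' q' Q "\<lambda>u. a u + b u + K u + L u"])
       (use that nonneg in \<open>auto intro: DERIV_subset[OF dQ]\<close>)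
  have "H \<ge> 0" using H[of s] Q_mono[of s "s + \<tau>"] \<open>\<tau> > 0\<close> by simp
  show ?case
  proof (cases "t \<le> p")
    case True
    have "1 * C \<le> (1 + H) * C" using \<open>H \<ge> 0\<close> \<open>C \<ge> 0\<close> by (intro mult_right_mono) auto
    then show ?thesis using IH[of t] True Suc.prems by (auto simp: C_def algebra_simps)
  next
    case False
    have t: "p \<le> t" "t \<le> p + \<tau>" using False Suc.prems by (auto simp: p_def algebra_simps)
    have Q: "C * (Q t - Q p) \<le> C * H"
      using H[OF \<open>p \<ge> s\<close>] Q_mono[of t "p + \<tau>"] t \<open>p \<ge> s\<close> \<open>C \<ge> 0\<close> by (intro mult_left_mono) auto
    have step: "\<bar>z t\<bar> \<le> (1 + H) * C"
      if dz: "\<And>u. u \<ge> s \<Longrightarrow> (z has_real_derivative (f u * v (u - \<tau>) - g u * w (u - \<tau>))) (at u within {s..})"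
        and fg: "\<And>u. u \<ge> s \<Longrightarrow> f u \<ge> 0 \<and> g u \<ge> 0 \<and> f u + g u \<le> a u + b u + K u + L u"
        and vw: "\<And>u. u \<in> {s-\<tau>..p} \<Longrightarrow> \<bar>v u\<bar> \<le> C \<and> \<bar>w u\<bar> \<le> C" and zp: "\<bar>z p\<bar> \<le> C"
      for z f g v w
    proof -
      have b: "\<bar>f u * v (u - \<tau>) - g u * w (u - \<tau>)\<bar> \<le> C * (a u + b u + K u + L u)"
        if "u \<in> {p..t}" for u
      proof -
        have u: "u \<ge> s" "u - \<tau> \<in> {s-\<tau>..p}" using that t \<open>p \<ge> s\<close> by auto
        have "\<bar>f u * v (u - \<tau>)\<bar> \<le> f u * C" "\<bar>g u * w (u - \<tau>)\<bar> \<le> g u * C"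
          using fg[OF u(1)] vw[OF u(2)] by (auto simp: abs_mult intro!: mult_left_mono)
        moreover have "(f u + g u) * C \<le> (a u + b u + K u + L u) * C"
          using fg[OF u(1)] \<open>C \<ge> 0\<close> by (intro mult_right_mono) auto
        ultimately show ?thesis by (simp add: algebra_simps)
      qed
      have dQ': "((\<lambda>u. C * Q u) has_real_derivative C * (a u + b u + K u + L u)) (at u within {p..t})"
        if "u \<in> {p..t}" for u
        by (rule DERIV_cmult, rule DERIV_subset[OF dQ]) (use that \<open>p \<ge> s\<close> in auto)
      have dz': "(z has_real_derivative (f u * v (u - \<tau>) - g u * w (u - \<tau>))) (at u within {p..t})"
        if "u \<in> {p..t}" for u
        by (rule DERIV_subset[OF dz]) (use that \<open>p \<ge> s\<close> in auto)
      have "z t - z p \<le> C * Q t - C * Q p"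
        by (rule increment_le_of_derivative_le[OF t(1) dz' dQ']) (use b in \<open>auto simp: abs_le_iff\<close>)
      moreover have "- z t - (- z p) \<le> C * Q t - C * Q p"
        by (rule increment_le_of_derivative_le[OF t(1) DERIV_minus[OF dz'] dQ']) (use b in \<open>auto simp: abs_le_iff\<close>)
      ultimately show ?thesis using Q zp by (simp add: abs_le_iff algebra_simps)
    qed
    have "\<bar>x t\<bar> \<le> (1 + H) * C"
      using step[of x K y a x] dx nonneg IH \<open>p \<ge> s\<close> \<open>\<tau> > 0\<close> by simp
    moreover have "\<bar>y t\<bar> \<le> (1 + H) * C"
      using step[of y L x b y] dy nonneg IH \<open>p \<ge> s\<close> \<open>\<tau> > 0\<close> by simp
    ultimately show ?thesis by (simp add: C_def algebra_simps)
  qed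
qed

section \<open>Exponential decay\<close>

text \<open>
  A positive maximum of \<open>exp (\<beta> u) max(|x(u)|, |y(u)|)\<close> at a point \<open>m > T\<close> contradicts the
  contraction estimate, which looks back at the coefficients on \<open>[m - 2\<tau>, m]\<close> and at the solution on
  \<open>[m - 3\<tau>, m]\<close>; this explains the times \<open>T - 2\<tau>\<close> and \<open>s + 3\<tau>\<close>. The condition \<open>\<beta> \<le> \<epsilon> a\<close> turns the decrease
  at relative rate \<open>\<beta>\<close>, allowed by the exponential weight, into the error \<open>\<epsilon>\<close> of the contraction
  estimate.
\<close>
lemma exponential_decay_of_dominance:
  fixes x y a b K L P R :: "real \<Rightarrow> real"
  assumes "\<tau> > 0" "\<beta> > 0" "\<epsilon> \<ge> 0" "\<gamma> \<le> 1"
    and contraction: "(\<gamma> + \<epsilon>) * exp (3 * \<beta> * \<tau>) < 1"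
    and T: "T \<ge> s + 3 * \<tau>"
    and dP: "\<And>u. u \<ge> s \<Longrightarrow> (P has_real_derivative a u) (at u within {s..})"
    and dR: "\<And>u. u \<ge> s \<Longrightarrow> (R has_real_derivative b u) (at u within {s..})"
    and pos: "\<And>u. u \<ge> s \<Longrightarrow> a u > 0" "\<And>u. u \<ge> s \<Longrightarrow> b u > 0"
             "\<And>u. u \<ge> s \<Longrightarrow> K u \<ge> 0" "\<And>u. u \<ge> s \<Longrightarrow> L u \<ge> 0"
    and dom: "\<And>u. u \<ge> T - 2 * \<tau> \<Longrightarrow> K u \<le> a u * (\<gamma> - (P u - P (u - \<tau>)))"
             "\<And>u. u \<ge> T - 2 * \<tau> \<Longrightarrow> L u \<le> b u * (\<gamma> - (R u - R (u - \<tau>)))"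
    and \<beta>: "\<And>u. u \<ge> T \<Longrightarrow> \<beta> \<le> \<epsilon> * a u" "\<And>u. u \<ge> T \<Longrightarrow> \<beta> \<le> \<epsilon> * b u"
    and cont: "continuous_on {s..} x" "continuous_on {s..} y"
    and dx: "\<And>u. u \<ge> s \<Longrightarrow>
               (x has_real_derivative (K u * y (u - \<tau>) - a u * x (u - \<tau>))) (at u within {s..})"
    and dy: "\<And>u. u \<ge> s \<Longrightarrow>
               (y has_real_derivative (L u * x (u - \<tau>) - b u * y (u - \<tau>))) (at u within {s..})"
    and init: "\<And>u. u \<in> {s..T} \<Longrightarrow> \<bar>x u\<bar> \<le> C \<and> \<bar>y u\<bar> \<le> C"
    and "t \<ge> s"
  shows "\<bar>x t\<bar> \<le> C * exp (\<beta> * (T - t)) \<and> \<bar>y t\<bar> \<le> C * exp (\<beta> * (T - t))"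
proof -
  define V where "V u = max \<bar>x u\<bar> \<bar>y u\<bar>" for u
  define F where "F u = exp (\<beta> * u) * V u" for u
  have "continuous_on {s..t} F"
    unfolding F_def V_def
    by (intro continuous_intros continuous_on_subset[OF cont(1)] continuous_on_subset[OF cont(2)]) auto
  then obtain m where m: "m \<in> {s..t}" "\<And>u. u \<in> {s..t} \<Longrightarrow> F u \<le> F m"
    using continuous_attains_sup[of "{s..t}" F] \<open>t \<ge> s\<close> by auto
  have "C \<ge> 0" using init[of s] T \<open>\<tau> > 0\<close> by force
  have F_m: "F m \<le> exp (\<beta> * T) * C"
  proof (cases "m \<le> T")
    case True
    with m init[of m] show ?thesis
      unfolding F_def V_def using \<open>\<beta> > 0\<close> \<open>C \<ge> 0\<close> by (intro mult_mono) auto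
  next
    case False
    define N where "N = exp (3 * \<beta> * \<tau>) * V m"
    have V_N: "V u \<le> N" if "u \<in> {m - 3 * \<tau>..m}" for u
    proof -
      have "exp (\<beta> * u) * V u \<le> exp (\<beta> * m) * V m"
        using m(2)[of u] that m(1) T False by (auto simp: F_def)
      then have "V u \<le> exp (\<beta> * (m - u)) * V m"
        by (simp add: exp_diff field_simps)
      also have "\<dots> \<le> N"
        unfolding N_def using that \<open>\<beta> > 0\<close> by (intro mult_right_mono) (auto simp: V_def)
      finally show ?thesis .
    qed
    \<comment> \<open>Stated for a generic component \<open>z\<close>, so as to cover \<open>x\<close>, \<open>y\<close> and their negatives at once.\<close>
    have no_peak: "V m \<le> 0"
      if peak: "z m = V m" and zw: "\<And>u. \<bar>z u\<bar> \<le> V u \<and> \<bar>w u\<bar> \<le> V u"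
        and dz: "\<And>u. u \<ge> s \<Longrightarrow>
               (z has_real_derivative (J u * w (u - \<tau>) - c u * z (u - \<tau>))) (at u within {s..})"
        and dS: "\<And>u. u \<ge> s \<Longrightarrow> (S has_real_derivative c u) (at u within {s..})"
        and c: "\<And>u. u \<ge> s \<Longrightarrow> c u > 0" and J: "\<And>u. u \<ge> s \<Longrightarrow> J u \<ge> 0"
        and J_le: "\<And>u. u \<ge> T - 2 * \<tau> \<Longrightarrow> J u \<le> c u * (\<gamma> - (S u - S (u - \<tau>)))"
        and \<beta>c: "\<And>u. u \<ge> T \<Longrightarrow> \<beta> \<le> \<epsilon> * c u"
      for z w c J S
    proof -
      define z' where "z' = J m * w (m - \<tau>) - c m * z (m - \<tau>)"
      have "(z has_real_derivative z') (at m within {s..m})"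
        unfolding z'_def by (rule DERIV_subset[OF dz]) (use m in auto)
      then have "((\<lambda>u. exp (\<beta> * u) * z u) has_real_derivative exp (\<beta> * m) * (z' + \<beta> * z m))
                  (at m within {s..m})"
        by (auto intro!: derivative_eq_intros simp: algebra_simps)
      moreover have "exp (\<beta> * u) * z u \<le> exp (\<beta> * m) * z m" if "u \<in> {s..m}" for u
      proof -
        have "exp (\<beta> * u) * z u \<le> F u" unfolding F_def
          using zw[of u] by (intro mult_left_mono) auto
        also have "\<dots> \<le> F m" using m that by auto
        finally show ?thesis by (simp add: F_def peak)
      qed
      ultimately have "exp (\<beta> * m) * (z' + \<beta> * z m) \<ge> 0"
        using derivative_nonneg_at_right_end_max False T \<open>\<tau> > 0\<close> by simp
      then have "z' \<ge> - (\<beta> * z m)" by (simp add: zero_le_mult_iff)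
      moreover have "\<beta> * z m \<le> \<epsilon> * c m * N"
        using \<beta>c[of m] V_N[of m] False \<open>\<beta> > 0\<close> \<open>\<tau> > 0\<close>
        by (intro mult_mono) (auto simp: peak V_def)
      ultimately have "z' \<ge> - (\<epsilon> * c m * N)" by linarith
      moreover have "\<bar>z u\<bar> \<le> N" "\<bar>w u\<bar> \<le> N" if "u \<in> {m - 3 * \<tau>..m}" for u
        using zw[of u] V_N[OF that] by auto
      ultimately have "z m \<le> (\<gamma> + \<epsilon>) * N"
        unfolding z'_def
      proof (intro peak_bound[of \<tau> m S c z J w \<gamma> N \<epsilon>])
        fix u assume "u \<in> {m - 3 * \<tau>..m}"
        then have "u \<ge> s" using False T by auto
        then show "(S has_real_derivative c u) (at u within {m - 3 * \<tau>..m})"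
          by (rule DERIV_subset[OF dS]) (use False T in auto)
        show "c u > 0" by (rule c) fact
      next
        fix u assume "u \<in> {m - 2 * \<tau>..m}"
        then have u: "u \<ge> s" "u \<ge> T - 2 * \<tau>" using False T \<open>\<tau> > 0\<close> by auto
        then show "(z has_real_derivative J u * w (u - \<tau>) - c u * z (u - \<tau>)) (at u within {m - 2 * \<tau>..m})"
          by (intro DERIV_subset[OF dz]) (use False T \<open>\<tau> > 0\<close> in auto)
        show "0 \<le> J u" by (rule J) fact
        show "J u \<le> c u * (\<gamma> - (S u - S (u - \<tau>)))" by (rule J_le) fact
      qed (use \<open>\<tau> > 0\<close> \<open>\<gamma> \<le> 1\<close> \<open>\<epsilon> \<ge> 0\<close> in auto)
      then have "V m * (1 - (\<gamma> + \<epsilon>) * exp (3 * \<beta> * \<tau>)) \<le> 0"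
        by (simp add: N_def peak algebra_simps)
      with contraction show ?thesis by (simp add: mult_le_0_iff)
    qed
    have dmx: "((\<lambda>u. - x u) has_real_derivative (K u * (- y (u - \<tau>)) - a u * (- x (u - \<tau>)))) (at u within {s..})"
      and dmy: "((\<lambda>u. - y u) has_real_derivative (L u * (- x (u - \<tau>)) - b u * (- y (u - \<tau>)))) (at u within {s..})"
      if "u \<ge> s" for u
      using DERIV_minus[OF dx[OF that]] DERIV_minus[OF dy[OF that]] by (simp_all add: algebra_simps)
    have VV: "\<And>u. \<bar>x u\<bar> \<le> V u" "\<And>u. \<bar>y u\<bar> \<le> V u" by (auto simp: V_def)
    consider "x m = V m" | "- x m = V m" | "y m = V m" | "- y m = V m"
      using that unfolding V_def by (smt (verit))
    then have "V m \<le> 0"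
    proof cases
      case 1
      then show ?thesis using no_peak[of x y K a P] VV dx dP pos dom \<beta> by simp
    next
      case 2
      then show ?thesis using no_peak[of "\<lambda>u. - x u" "\<lambda>u. - y u" K a P] VV dmx dP pos dom \<beta> by simp
    next
      case 3
      then show ?thesis using no_peak[of y x L b R] VV dy dR pos dom \<beta> by simp
    next
      case 4
      then show ?thesis using no_peak[of "\<lambda>u. - y u" "\<lambda>u. - x u" L b R] VV dmy dR pos dom \<beta> by simp
    qed
    then have "F m \<le> 0" by (simp add: F_def mult_le_0_iff)
    also have "0 \<le> exp (\<beta> * T) * C" using \<open>C \<ge> 0\<close> by simp
    finally show ?thesis .
  qed
  have "exp (\<beta> * t) * V t \<le> exp (\<beta> * T) * C"
    using m(2)[of t] F_m \<open>t \<ge> s\<close> by (simp add: F_def)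
  then have "V t \<le> C * exp (\<beta> * (T - t))" by (simp add: exp_diff field_simps)
  then show ?thesis by (auto simp: V_def)
qed

lemma exists_small_rate:
  fixes q \<tau> M :: real
  assumes "q < 1" "\<tau> > 0" "M > 0"
  shows "\<exists>\<beta>>0. \<beta> \<le> M \<and> q * exp (3 * \<beta> * \<tau>) < 1"
proof -
  have "((\<lambda>\<beta>. q * exp (3 * \<beta> * \<tau>)) \<longlongrightarrow> q * exp (3 * 0 * \<tau>)) (at_right 0)"
    by (intro tendsto_intros)
  then have "\<forall>\<^sub>F \<beta> in at_right 0. q * exp (3 * \<beta> * \<tau>) < 1"
    by (rule order_tendstoD(2)) (use \<open>q < 1\<close> in simp)
  moreover have "\<forall>\<^sub>F \<beta> in at_right 0. 0 < \<beta> \<and> \<beta> < M"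
    using \<open>M > 0\<close> by (auto simp: eventually_at_right)
  ultimately have "\<forall>\<^sub>F \<beta> in at_right 0. 0 < \<beta> \<and> \<beta> \<le> M \<and> q * exp (3 * \<beta> * \<tau>) < 1"
    by eventually_elim auto
  then show ?thesis using eventually_happens[of _ "at_right (0::real)"] by auto
qed

section \<open>Diagonal dominance from the two alternative hypotheses\<close>

text \<open>
  The condition on one row of the system that both hypotheses imply, in quantitative form; \<open>\<rho>\<close> is
  the ratio of the components of \<open>v\<close>, the component of the other unknown being the numerator.
\<close>
definition row_dominated :: "real \<Rightarrow> (real \<Rightarrow> real) \<Rightarrow> (real \<Rightarrow> real) \<Rightarrow> real \<Rightarrow> bool" where
  "row_dominated \<tau> p q \<rho> \<longleftrightarrow>
     (\<exists>\<gamma><1. \<exists>m>0. \<forall>\<^sub>F t in at_top. m \<le> p t \<and> cfun \<tau> p q t + \<rho> * q t \<le> \<gamma> * p t)"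

text \<open>
  A positive lower limit leaves a gap \<open>\<delta>\<close> in \<open>(p - c) v - q w > \<delta>\<close>. It bounds \<open>p\<close> from below by
  \<open>\<delta> / v\<close>, and since \<open>p\<close> is bounded above by \<open>A\<close>, the gap is at least the fixed
  fraction \<open>\<delta> / (A v)\<close> of \<open>p v\<close>.
\<close>
lemma row_dominated_of_liminf:
  fixes p q :: "real \<Rightarrow> real"
  assumes "bounded (p ` {t0..})" "v > 0" "w > 0"
    and pq: "\<And>t. t \<ge> t0 \<Longrightarrow> p t > 0" "\<And>t. t \<ge> t0 \<Longrightarrow> q t \<ge> 0"
    and c: "\<forall>\<^sub>F t in at_top. cfun \<tau> p q t \<ge> 0"
    and lim: "Liminf at_top (\<lambda>t. ereal ((p t - cfun \<tau> p q t) * v - q t * w)) > 0"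
  shows "row_dominated \<tau> p q (w / v)"
proof -
  obtain A where A: "\<And>t. t \<ge> t0 \<Longrightarrow> p t \<le> A"
    using bounded_imp_bdd_above[OF assms(1)] by (auto simp: bdd_above_def)
  have "A > 0" using A[of t0] pq(1)[of t0] by simp
  obtain \<delta> where \<delta>: "\<delta> > 0" "ereal \<delta> < Liminf at_top (\<lambda>t. ereal ((p t - cfun \<tau> p q t) * v - q t * w))"
    using ereal_dense2[OF lim] by auto
  have "\<forall>\<^sub>F t in at_top. \<delta> < (p t - cfun \<tau> p q t) * v - q t * w"
    using less_LiminfD[OF \<delta>(2)] by simp
  then have "\<forall>\<^sub>F t in at_top. \<delta> / v \<le> p t \<and> cfun \<tau> p q t + w / v * q t \<le> (1 - \<delta> / (A * v)) * p t"
    using c eventually_ge_at_top[of t0]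
  proof eventually_elim
    case (elim t)
    have "cfun \<tau> p q t * v \<ge> 0" "q t * w \<ge> 0" using elim pq(2)[of t] assms by auto
    with elim have 1: "\<delta> \<le> p t * v" by (simp add: algebra_simps)
    have "\<delta> * p t \<le> \<delta> * A" using A[of t] elim \<delta>(1) by simp
    then have 2: "\<delta> / (A * v) * p t \<le> \<delta> / v"
      using \<open>A > 0\<close> \<open>v > 0\<close> by (simp add: field_simps)
    have "cfun \<tau> p q t + w / v * q t \<le> p t - \<delta> / v"
      using divide_right_mono[of "cfun \<tau> p q t * v + q t * w" "p t * v - \<delta>" v] elim(1) \<open>v > 0\<close>
      by (simp add: algebra_simps add_divide_distrib diff_divide_distrib)
    moreover have "\<delta> / v \<le> p t" using 1 \<open>v > 0\<close> by (simp add: field_simps)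
    ultimately show ?case using 2 by (simp add: left_diff_distrib)
  qed
  moreover have "1 - \<delta> / (A * v) < 1" "\<delta> / v > 0" using \<delta>(1) \<open>A > 0\<close> \<open>v > 0\<close> by auto
  ultimately show ?thesis unfolding row_dominated_def by blast
qed

lemma row_dominated_of_factor:
  fixes p q :: "real \<Rightarrow> real"
  assumes "\<alpha> > 1" "v > 0" "m > 0" "\<And>t. t \<ge> t0 \<Longrightarrow> m \<le> p t"
    and "\<forall>\<^sub>F t in at_top. p t * v \<ge> \<alpha> * (cfun \<tau> p q t * v + q t * w)"
  shows "row_dominated \<tau> p q (w / v)"
proof -
  have "\<forall>\<^sub>F t in at_top. m \<le> p t \<and> cfun \<tau> p q t + w / v * q t \<le> 1 / \<alpha> * p t"
    using assms(5) eventually_ge_at_top[of t0]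
    by eventually_elim (use assms in \<open>auto simp: field_simps\<close>)
  moreover have "1 / \<alpha> < 1" using \<open>\<alpha> > 1\<close> by simp
  ultimately show ?thesis unfolding row_dominated_def using \<open>m > 0\<close> by blast
qed

lemma mat2_mult_vec:
  "(mat2 p q r s *v v) $ 1 = p * v $ 1 + q * v $ 2"
  "(mat2 p q r s *v v) $ 2 = r * v $ 1 + s * v $ 2"
  by (simp_all add: mat2_def matrix_vector_mult_def sum_2)

section \<open>Stability\<close>

text \<open>
  Assembles the estimates for the rescaled solution \<open>(x, y / \<rho>)\<close>. The number \<open>n\<close> of steps is chosen
  such that \<open>s + n\<tau> - 2\<tau>\<close> lies beyond the time \<open>T0\<close> of dominance for every initial time \<open>s \<ge> t0\<close>;
  this makes \<open>n\<close>, and with it the final constant, independent of \<open>s\<close>.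
\<close>
lemma exp_asymp_stable_of_row_dominated:
  fixes t0 \<tau> \<rho> :: real and a b k l :: "real \<Rightarrow> real"
  assumes "\<tau> > 0" "\<rho> > 0"
    and cont: "continuous_on {t0..} a" "continuous_on {t0..} b"
              "continuous_on {t0..} k" "continuous_on {t0..} l"
    and pos: "\<And>t. t \<ge> t0 \<Longrightarrow> a t > 0" "\<And>t. t \<ge> t0 \<Longrightarrow> b t > 0"
             "\<And>t. t \<ge> t0 \<Longrightarrow> k t \<ge> 0" "\<And>t. t \<ge> t0 \<Longrightarrow> l t \<ge> 0"
    and rows: "row_dominated \<tau> a k \<rho>" "row_dominated \<tau> b l (1 / \<rho>)"
  shows "exp_asymp_stable t0 \<tau> a b k l"
proof -
  define K where "K t = \<rho> * k t" for t
  define L where "L t = 1 / \<rho> * l t" for t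
  define P where "P u = integral {t0..u} a" for u
  define R where "R u = integral {t0..u} b" for u
  define Q where "Q u = integral {t0..u} (\<lambda>t. a t + b t + K t + L t)" for u
  have dP: "(P has_real_derivative a u) (at u within {t0..})" if "u \<ge> t0" for u
    unfolding P_def by (rule primitive_has_derivative[OF cont(1) that])
  have dR: "(R has_real_derivative b u) (at u within {t0..})" if "u \<ge> t0" for u
    unfolding R_def by (rule primitive_has_derivative[OF cont(2) that])
  have dQ: "(Q has_real_derivative (a u + b u + K u + L u)) (at u within {t0..})" if "u \<ge> t0" for u
    unfolding Q_def K_def L_def
    by (rule primitive_has_derivative[OF _ that]) (intro continuous_intros cont)
  have KL: "K t \<ge> 0" "L t \<ge> 0" if "t \<ge> t0" for t
    using pos that \<open>\<rho> > 0\<close> by (auto simp: K_def L_def)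

  obtain \<gamma>1 m1 where 1: "\<gamma>1 < 1" "m1 > 0" "\<forall>\<^sub>F t in at_top. m1 \<le> a t \<and> cfun \<tau> a k t + K t \<le> \<gamma>1 * a t"
    using rows(1) unfolding row_dominated_def K_def by blast
  obtain \<gamma>2 m2 where 2: "\<gamma>2 < 1" "m2 > 0" "\<forall>\<^sub>F t in at_top. m2 \<le> b t \<and> cfun \<tau> b l t + L t \<le> \<gamma>2 * b t"
    using rows(2) unfolding row_dominated_def L_def by blast
  define \<gamma> where "\<gamma> = max \<gamma>1 \<gamma>2"
  define m where "m = min m1 m2"
  have "\<gamma> < 1" "m > 0" using 1 2 by (auto simp: \<gamma>_def m_def)
  obtain T1 where T1: "\<And>t. t \<ge> T1 \<Longrightarrow> (m1 \<le> a t \<and> cfun \<tau> a k t + K t \<le> \<gamma>1 * a t)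
                                  \<and> (m2 \<le> b t \<and> cfun \<tau> b l t + L t \<le> \<gamma>2 * b t)"
    using eventually_conj[OF 1(3) 2(3)] unfolding eventually_at_top_linorder by blast
  define T0 where "T0 = max T1 (t0 + \<tau>)"
  \<comment> \<open>One row, for generic coefficients: the integral in \<open>cfun\<close> is at least that of \<open>p\<close> alone.\<close>
  have row: "m' \<le> p t \<and> J t \<le> p t * (\<gamma>' - (S t - S (t - \<tau>)))"
    if "t \<ge> T0" and p: "continuous_on {t0..} p" "\<And>t. t \<ge> t0 \<Longrightarrow> p t > 0"
      and q: "continuous_on {t0..} q" "\<And>t. t \<ge> t0 \<Longrightarrow> q t \<ge> 0"
      and S: "\<And>u. S u = integral {t0..u} p"
      and le: "m'' \<le> p t \<and> cfun \<tau> p q t + J t \<le> \<gamma>'' * p t" and "m' \<le> m''" "\<gamma>'' \<le> \<gamma>'"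
    for p q J S m' m'' \<gamma>' \<gamma>'' t
  proof -
    have t: "t - \<tau> \<ge> t0" "t \<ge> t0" using \<open>t \<ge> T0\<close> \<open>\<tau> > 0\<close> by (auto simp: T0_def)
    have int: "f integrable_on {t-\<tau>..t}" if "continuous_on {t0..} f" for f :: "real \<Rightarrow> real"
      by (rule integrable_continuous_real) (use that t in \<open>auto intro: continuous_on_subset\<close>)
    have "S t - S (t - \<tau>) = integral {t-\<tau>..t} p"
      using integral_window[OF p(1), of "t - \<tau>" t] t \<open>\<tau> > 0\<close> by (simp add: S)
    also have "\<dots> \<le> integral {t-\<tau>..t} (\<lambda>u. p u + q u)"
      by (intro integral_le int continuous_intros p q) (use q t in auto)
    finally have "p t * (S t - S (t - \<tau>)) \<le> cfun \<tau> p q t"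
      unfolding cfun_def using p(2)[OF t(2)] by simp
    moreover have "\<gamma>'' * p t \<le> \<gamma>' * p t" using \<open>\<gamma>'' \<le> \<gamma>'\<close> p(2)[OF t(2)] by simp
    ultimately show ?thesis using le \<open>m' \<le> m''\<close> by (simp add: algebra_simps)
  qed
  have row_a: "m \<le> a t \<and> K t \<le> a t * (\<gamma> - (P t - P (t - \<tau>)))" if "t \<ge> T0" for t
    by (rule row[OF that cont(1) pos(1) cont(3) pos(3), of P m1 K \<gamma>1])
       (use T1[of t] that in \<open>auto simp: T0_def P_def m_def \<gamma>_def\<close>)
  have row_b: "m \<le> b t \<and> L t \<le> b t * (\<gamma> - (R t - R (t - \<tau>)))" if "t \<ge> T0" for t
    by (rule row[OF that cont(2) pos(2) cont(4) pos(4), of R m2 L \<gamma>2])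
       (use T1[of t] that in \<open>auto simp: T0_def R_def m_def \<gamma>_def\<close>)
  have "T0 \<ge> t0 + \<tau>" by (simp add: T0_def)

  \<comment> \<open>The integral of a dominating coefficient over a window is at most \<open>\<gamma>\<close>, as the coupling is
     nonnegative.\<close>
  have window: "S t - S (t - \<tau>) \<le> 1" if "J t \<le> p t * (\<gamma> - (S t - S (t - \<tau>)))" "J t \<ge> 0" "p t > 0"
    for J p S and t :: real
  proof -
    have "0 \<le> p t * (\<gamma> - (S t - S (t - \<tau>)))" using that by linarith
    with \<open>p t > 0\<close> \<open>\<gamma> < 1\<close> show ?thesis by (simp add: zero_le_mult_iff)
  qed
  have mono: "S u \<le> S u'" if "t0 \<le> u" "u \<le> u'"
    and "\<And>u. u \<ge> t0 \<Longrightarrow> (S has_real_derivative p u) (at u within {t0..})"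
    and "\<And>u. u \<ge> t0 \<Longrightarrow> p u > 0" for S p u u'
    by (rule le_of_derivative_nonneg[of u u' S p])
       (use that in \<open>auto intro: DERIV_subset[OF that(3)] order.strict_implies_order\<close>)
  \<comment> \<open>Beyond \<open>T0\<close>, \<open>K \<le> a\<close> and \<open>L \<le> b\<close> hold, so all four coefficients together contribute at most
     twice the windows of \<open>a\<close> and \<open>b\<close>.\<close>
  have "Q (u + \<tau>) - Q u \<le> 4" if "u \<ge> T0" for u
  proof -
    have u: "u \<ge> t0" using that \<open>T0 \<ge> t0 + \<tau>\<close> \<open>\<tau> > 0\<close> by simp
    have dom: "K r \<le> a r" "L r \<le> b r" if r: "r \<ge> u" for r
    proof -
      have r0: "r - \<tau> \<ge> t0" "r \<ge> t0" "r \<ge> T0" using r \<open>u \<ge> T0\<close> \<open>T0 \<ge> t0 + \<tau>\<close> u by auto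
      have "a r * (\<gamma> - (P r - P (r - \<tau>))) \<le> a r * 1"
        using pos(1)[OF r0(2)] mono[of "r - \<tau>" r P a, OF _ _ dP pos(1)] r0 \<open>\<tau> > 0\<close> \<open>\<gamma> < 1\<close>
        by (intro mult_left_mono) auto
      then show "K r \<le> a r" using row_a[OF r0(3)] by simp
      have "b r * (\<gamma> - (R r - R (r - \<tau>))) \<le> b r * 1"
        using pos(2)[OF r0(2)] mono[of "r - \<tau>" r R b, OF _ _ dR pos(2)] r0 \<open>\<tau> > 0\<close> \<open>\<gamma> < 1\<close>
        by (intro mult_left_mono) auto
      then show "L r \<le> b r" using row_b[OF r0(3)] by simp
    qed
    have "Q (u + \<tau>) - Q u \<le> 2 * (P (u + \<tau>) + R (u + \<tau>)) - 2 * (P u + R u)"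
    proof (rule increment_le_of_derivative_le[where f = Q and f' = "\<lambda>r. a r + b r + K r + L r"
          and g = "\<lambda>r. 2 * (P r + R r)" and g' = "\<lambda>r. 2 * (a r + b r)"])
      fix r assume r: "r \<in> {u..u + \<tau>}"
      then have r0: "r \<ge> t0" using u by simp
      have sub: "{u..u + \<tau>} \<subseteq> {t0..}" using u by auto
      show "(Q has_real_derivative a r + b r + K r + L r) (at r within {u..u + \<tau>})"
        by (rule DERIV_subset[OF dQ[OF r0] sub])
      show "((\<lambda>r. 2 * (P r + R r)) has_real_derivative 2 * (a r + b r)) (at r within {u..u + \<tau>})"
        by (intro DERIV_cmult DERIV_add DERIV_subset[OF dP[OF r0] sub] DERIV_subset[OF dR[OF r0] sub])
      show "a r + b r + K r + L r \<le> 2 * (a r + b r)" using dom[of r] r by simp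
    qed (use \<open>\<tau> > 0\<close> in simp)
    moreover have "P (u + \<tau>) - P u \<le> 1"
      using window[of K "u + \<tau>" a P] row_a[of "u + \<tau>"] KL(1)[of "u + \<tau>"] pos(1)[of "u + \<tau>"] that u \<open>\<tau> > 0\<close>
      by simp
    moreover have "R (u + \<tau>) - R u \<le> 1"
      using window[of L "u + \<tau>" b R] row_b[of "u + \<tau>"] KL(2)[of "u + \<tau>"] pos(2)[of "u + \<tau>"] that u \<open>\<tau> > 0\<close>
      by simp
    ultimately show ?thesis by simp
  qed
  moreover have "continuous_on {t0..} Q"
    using dQ by (auto intro!: DERIV_continuous_on)
  ultimately obtain H where H: "H \<ge> 0" "\<And>u. u \<ge> t0 \<Longrightarrow> Q (u + \<tau>) - Q u \<le> H"
    using window_bound[of t0 Q \<tau> T0 4] \<open>\<tau> > 0\<close> by auto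

  \<comment> \<open>Half of the gap in \<open>\<gamma> < 1\<close> absorbs the exponential weight.\<close>
  define \<epsilon> where "\<epsilon> = (1 - \<gamma>) / 2"
  have \<epsilon>: "\<epsilon> > 0" "\<gamma> + \<epsilon> < 1" using \<open>\<gamma> < 1\<close> by (auto simp: \<epsilon>_def field_simps)
  obtain \<beta> where \<beta>: "\<beta> > 0" "\<beta> \<le> \<epsilon> * m" "(\<gamma> + \<epsilon>) * exp (3 * \<beta> * \<tau>) < 1"
    using exists_small_rate[OF \<epsilon>(2) \<open>\<tau> > 0\<close>, of "\<epsilon> * m"] \<epsilon>(1) \<open>m > 0\<close> by auto
  obtain n :: nat where n: "real n * \<tau> \<ge> T0 - t0 + 3 * \<tau>"
    using reals_Archimedean3[OF \<open>\<tau> > 0\<close>] less_imp_le by blast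
  define D where "D = (1 + H) ^ n * (1 + 1 / \<rho>)"
  have "D > 0" using H(1) \<open>\<rho> > 0\<close> by (auto simp: D_def intro!: mult_pos_pos add_pos_pos)
  define M where "M = (1 + \<rho>) * D * exp (\<beta> * (real n * \<tau>))"
  have "M > 0" using \<open>D > 0\<close> \<open>\<rho> > 0\<close> by (simp add: M_def)

  have "norm (X t) \<le> M * exp (- \<beta> * (t - s)) * hist_norm \<tau> \<phi>"
    if "s \<ge> t0" and \<phi>: "continuous_on {-\<tau>..0} \<phi>" and X: "delay_solution \<tau> a b k l s \<phi> X" and "t \<ge> s"
    for s \<phi> X t
  proof -
    define x where "x u = X u $ 1" for u
    define y where "y u = X u $ 2 / \<rho>" for u
    define T where "T = s + real n * \<tau>"
    have contX: "continuous_on {s - \<tau>..} X"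
      and hist: "\<And>\<theta>. \<theta> \<in> {-\<tau>..0} \<Longrightarrow> X (s + \<theta>) = \<phi> \<theta>"
      and dX1: "\<And>u. u \<ge> s \<Longrightarrow> ((\<lambda>r. X r $ 1) has_real_derivative
                  (k u * X (u - \<tau>) $ 2 - a u * X (u - \<tau>) $ 1)) (at u within {s..})"
      and dX2: "\<And>u. u \<ge> s \<Longrightarrow> ((\<lambda>r. X r $ 2) has_real_derivative
                  (l u * X (u - \<tau>) $ 1 - b u * X (u - \<tau>) $ 2)) (at u within {s..})"
      using X by (auto simp: delay_solution_def)
    have dx: "(x has_real_derivative (K u * y (u - \<tau>) - a u * x (u - \<tau>))) (at u within {s..})"
      and dy: "(y has_real_derivative (L u * x (u - \<tau>) - b u * y (u - \<tau>))) (at u within {s..})"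
      if "u \<ge> s" for u
      using dX1[OF that] DERIV_cdivide[OF dX2[OF that], of \<rho>] \<open>\<rho> > 0\<close>
      by (simp_all add: x_def[abs_def] y_def[abs_def] K_def L_def field_simps)
    have sub: "{s..} \<subseteq> {t0..}" using \<open>s \<ge> t0\<close> by auto
    have contxy: "continuous_on {s..} x" "continuous_on {s..} y"
      by (rule DERIV_continuous_on, use dx dy in auto)+

    have init: "\<bar>x u\<bar> \<le> (1 + 1 / \<rho>) * hist_norm \<tau> \<phi> \<and> \<bar>y u\<bar> \<le> (1 + 1 / \<rho>) * hist_norm \<tau> \<phi>"
      if "u \<in> {s - \<tau>..s}" for u
    proof -
      have "u - s \<in> {-\<tau>..0}" using that by auto
      moreover have "bdd_above ((\<lambda>\<theta>. norm (\<phi> \<theta>)) ` {-\<tau>..0})"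
        by (intro bounded_imp_bdd_above compact_imp_bounded compact_continuous_image continuous_intros \<phi>) auto
      ultimately have "norm (\<phi> (u - s)) \<le> hist_norm \<tau> \<phi>"
        unfolding hist_norm_def by (rule cSUP_upper)
      then have N: "norm (X u) \<le> hist_norm \<tau> \<phi>" using hist[of "u - s"] \<open>u - s \<in> _\<close> by simp
      have N1: "\<bar>X u $ 1\<bar> \<le> hist_norm \<tau> \<phi>" and N2: "\<bar>X u $ 2\<bar> \<le> hist_norm \<tau> \<phi>"
        using N component_le_norm_cart[of "X u"] by (metis order_trans)+
      then have "\<bar>y u\<bar> \<le> hist_norm \<tau> \<phi> / \<rho>"
        using \<open>\<rho> > 0\<close> by (simp add: y_def divide_right_mono)
      moreover have "hist_norm \<tau> \<phi> \<ge> 0" using N norm_ge_zero order_trans by blast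
      then have "hist_norm \<tau> \<phi> / \<rho> \<ge> 0" using \<open>\<rho> > 0\<close> by simp
      ultimately show ?thesis using N1 \<open>hist_norm \<tau> \<phi> \<ge> 0\<close> by (simp add: x_def algebra_simps)
    qed
    have grow: "\<bar>x u\<bar> \<le> D * hist_norm \<tau> \<phi> \<and> \<bar>y u\<bar> \<le> D * hist_norm \<tau> \<phi>" if "u \<in> {s - \<tau>..T}" for u
      unfolding D_def mult.assoc
    proof (rule growth_by_steps[of \<tau> s Q a b K L H x y])
      fix r assume "r \<ge> s"
      then have r: "r \<ge> t0" using \<open>s \<ge> t0\<close> by simp
      show "(Q has_real_derivative a r + b r + K r + L r) (at r within {s..})"
        by (rule DERIV_subset[OF dQ[OF r] sub])
      show "Q (r + \<tau>) - Q r \<le> H" by (rule H(2)[OF r])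
      show "0 \<le> a r" "0 \<le> b r" "0 \<le> K r" "0 \<le> L r"
        using pos(1,2)[OF r] KL[OF r] by auto
    qed (use that \<open>\<tau> > 0\<close> dx dy init in \<open>auto simp: T_def\<close>)
    have T: "T \<ge> s + 3 * \<tau>" "T - 2 * \<tau> \<ge> T0" "T \<ge> T0"
      using n \<open>s \<ge> t0\<close> \<open>T0 \<ge> t0 + \<tau>\<close> \<open>\<tau> > 0\<close> unfolding T_def by linarith+
    have rate: "\<beta> \<le> \<epsilon> * c" if "m \<le> c" for c
      using \<beta>(2) mult_left_mono[OF that, of \<epsilon>] \<epsilon>(1) by linarith
    have "\<bar>x t\<bar> \<le> D * hist_norm \<tau> \<phi> * exp (\<beta> * (T - t)) \<and> \<bar>y t\<bar> \<le> D * hist_norm \<tau> \<phi> * exp (\<beta> * (T - t))"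
    proof (rule exponential_decay_of_dominance[of \<tau> \<beta> \<epsilon> \<gamma> s T P a R b K L x y])
      fix u assume "u \<ge> s"
      then have u: "u \<ge> t0" using \<open>s \<ge> t0\<close> by simp
      show "(P has_real_derivative a u) (at u within {s..})" "(R has_real_derivative b u) (at u within {s..})"
        by (rule DERIV_subset[OF dP[OF u] sub], rule DERIV_subset[OF dR[OF u] sub])
      show "0 < a u" "0 < b u" "0 \<le> K u" "0 \<le> L u"
        using pos(1,2)[OF u] KL[OF u] by auto
    next
      fix u assume "u \<ge> T - 2 * \<tau>"
      then have "u \<ge> T0" using T by simp
      then show "K u \<le> a u * (\<gamma> - (P u - P (u - \<tau>)))" "L u \<le> b u * (\<gamma> - (R u - R (u - \<tau>)))"
        using row_a row_b by auto
    next
      fix u assume "u \<ge> T"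
      then have "u \<ge> T0" using T by simp
      then show "\<beta> \<le> \<epsilon> * a u" "\<beta> \<le> \<epsilon> * b u" using row_a row_b rate by auto
    qed (use \<open>\<tau> > 0\<close> \<beta> \<epsilon> \<open>\<gamma> < 1\<close> T contxy dx dy grow \<open>t \<ge> s\<close> in auto)
    moreover have "norm (X t) \<le> \<bar>x t\<bar> + \<rho> * \<bar>y t\<bar>"
      using norm_le_l1_cart[of "X t"] \<open>\<rho> > 0\<close> by (simp add: sum_2 x_def y_def)
    moreover have "\<rho> * \<bar>y t\<bar> \<le> \<rho> * (D * hist_norm \<tau> \<phi> * exp (\<beta> * (T - t)))"
      using calculation(1) \<open>\<rho> > 0\<close> by (intro mult_left_mono) auto
    ultimately have "norm (X t) \<le> (1 + \<rho>) * (D * hist_norm \<tau> \<phi> * exp (\<beta> * (T - t)))"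
      by (simp add: algebra_simps)
    also have "exp (\<beta> * (T - t)) = exp (\<beta> * (real n * \<tau>)) * exp (- \<beta> * (t - s))"
      by (simp add: T_def exp_add[symmetric] algebra_simps)
    finally show ?thesis by (simp add: M_def mult_ac)
  qed
  then show ?thesis
    unfolding exp_asymp_stable_def using \<open>M > 0\<close> \<beta>(1) by blast
qed

theorem theorem3p1:
  fixes t0 \<tau> :: real and a b k l :: "real \<Rightarrow> real"
  assumes "\<tau> > 0"
    and "continuous_on {t0..} a" "continuous_on {t0..} b"
        "continuous_on {t0..} k" "continuous_on {t0..} l"
    and "\<And>t. t \<ge> t0 \<Longrightarrow> a t > 0" "\<And>t. t \<ge> t0 \<Longrightarrow> b t > 0"
        "\<And>t. t \<ge> t0 \<Longrightarrow> k t \<ge> 0" "\<And>t. t \<ge> t0 \<Longrightarrow> l t \<ge> 0"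
    and "(bounded (a ` {t0..}) \<and> bounded (b ` {t0..}) \<and> bounded (k ` {t0..}) \<and> bounded (l ` {t0..}) \<and>
          (\<exists>v::real^2. v $ 1 > 0 \<and> v $ 2 > 0 \<and>
             (\<forall>i. Liminf at_top (\<lambda>t. ereal ((M_hat \<tau> a b k l t *v v) $ i)) > 0)))
         \<or>
         ((\<exists>m>0. \<forall>t\<ge>t0. a t \<ge> m) \<and> (\<exists>m>0. \<forall>t\<ge>t0. b t \<ge> m) \<and>
          (\<exists>\<alpha>>1. \<exists>v::real^2. v $ 1 > 0 \<and> v $ 2 > 0 \<and>
             (\<forall>\<^sub>F t in at_top.
                mat2 (a t) 0 0 (b t) *v v
                  \<ge> \<alpha> *\<^sub>R (mat2 (cfun \<tau> a k t) (k t) (l t) (cfun \<tau> b l t) *v v))))"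
  shows "exp_asymp_stable t0 \<tau> a b k l"
proof -
  have cfun_nonneg: "\<forall>\<^sub>F t in at_top. cfun \<tau> p q t \<ge> 0"
    if "\<And>t. t \<ge> t0 \<Longrightarrow> p t > 0" "\<And>t. t \<ge> t0 \<Longrightarrow> q t \<ge> 0" for p q
    using eventually_ge_at_top[of "t0 + \<tau>"]
  proof eventually_elim
    case (elim t)
    have "p u + q u \<ge> 0" if "u \<in> {t-\<tau>..t}" for u
      using elim that \<open>\<And>t. t \<ge> t0 \<Longrightarrow> p t > 0\<close>[of u] \<open>\<And>t. t \<ge> t0 \<Longrightarrow> q t \<ge> 0\<close>[of u] by simp
    then have "integral {t-\<tau>..t} (\<lambda>u. p u + q u) \<ge> 0"
      by (cases "(\<lambda>u. p u + q u) integrable_on {t-\<tau>..t}")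
         (auto intro: integral_nonneg simp: not_integrable_integral)
    moreover have "p t > 0" using that(1)[of t] elim \<open>\<tau> > 0\<close> by simp
    ultimately show ?case by (simp add: cfun_def)
  qed
  have "\<exists>\<rho>>0. row_dominated \<tau> a k \<rho> \<and> row_dominated \<tau> b l (1 / \<rho>)"
    using assms(10)
  proof (elim disjE conjE exE)
    fix v :: "real^2"
    assume v: "v $ 1 > 0" "v $ 2 > 0" and bdd: "bounded (a ` {t0..})" "bounded (b ` {t0..})"
      and lim: "\<forall>i. Liminf at_top (\<lambda>t. ereal ((M_hat \<tau> a b k l t *v v) $ i)) > 0"
    have "row_dominated \<tau> a k (v $ 2 / v $ 1)"
      by (rule row_dominated_of_liminf[OF bdd(1) v(1,2) assms(6,8) cfun_nonneg[OF assms(6,8)]])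
         (use lim[rule_format, of 1] in \<open>auto simp: M_hat_def mat2_mult_vec\<close>)
    moreover have "row_dominated \<tau> b l (v $ 1 / v $ 2)"
      by (rule row_dominated_of_liminf[OF bdd(2) v(2,1) assms(7,9) cfun_nonneg[OF assms(7,9)]])
         (use lim[rule_format, of 2] in \<open>auto simp: M_hat_def mat2_mult_vec\<close>)
    ultimately show ?thesis using v by (intro exI[of _ "v $ 2 / v $ 1"]) auto
  next
    fix m1 m2 \<alpha> :: real and v :: "real^2"
    assume v: "v $ 1 > 0" "v $ 2 > 0" and "\<alpha> > 1"
      and m: "m1 > 0" "\<forall>t\<ge>t0. m1 \<le> a t" "m2 > 0" "\<forall>t\<ge>t0. m2 \<le> b t"
      and ev: "\<forall>\<^sub>F t in at_top. \<alpha> *\<^sub>R (mat2 (cfun \<tau> a k t) (k t) (l t) (cfun \<tau> b l t) *v v)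
                 \<le> mat2 (a t) 0 0 (b t) *v v"
    have "row_dominated \<tau> a k (v $ 2 / v $ 1)"
      by (rule row_dominated_of_factor[OF \<open>\<alpha> > 1\<close> v(1) m(1), of t0])
         (use m in \<open>auto intro: eventually_mono[OF ev] simp: less_eq_vec_def forall_2 mat2_mult_vec\<close>)
    moreover have "row_dominated \<tau> b l (v $ 1 / v $ 2)"
      by (rule row_dominated_of_factor[OF \<open>\<alpha> > 1\<close> v(2) m(3), of t0])
         (use m in \<open>auto intro: eventually_mono[OF ev] simp: less_eq_vec_def forall_2 mat2_mult_vec add.commute\<close>)
    ultimately show ?thesis using v by (intro exI[of _ "v $ 2 / v $ 1"]) auto
  qed
  then show ?thesis
    using exp_asymp_stable_of_row_dominated assms(1-9) by blast
qed

end
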